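(* Let $d\ge1$ and let $SPP$ be the set of symmetric positive definite symplectic matrices in $\mathbb{R}^{2d\times 2d}$. Then $SPP\subsetneq\mathcal{L}_{4}$. Thus any symmetric positive definite symplectic matrix can be factored into no more than $4$ unit triangular symplectic matrices.
   Context: Let $I=I_d$ and $J=\begin{bmatrix} 0 & I_{d} \\ -I_{d} & 0 \end{bmatrix}$. A real $2d\times 2d$ matrix $H$ is symplectic if $H^{T}JH=J$. The unit triangular symplectic matrices are those of the form $\begin{bmatrix} I & S \\ 0 & I\end{bmatrix}$ (upper) or $\begin{bmatrix} I & 0 \\ S & I\end{bmatrix}$ (lower) with $S\in\mathbb{R}^{d\times d}$ symmetric. For $n\ge1$, $\mathcal{L}_{n}$ is the set of all products $M_n\cdots M_2M_1$ where $M_i=\begin{bmatrix} I & S_i \\ 0 & I\end{bmatrix}$ for $i$ odd and $M_i=\begin{bmatrix} I & 0 \\ S_i & I\end{bmatrix}$ for $i$ even, with $S_1,\dots,S_n\in\mathbb{R}^{d\times d}$ arbitrary symmetric matrices. The symbol $\subsetneq$ denotes proper inclusion. *)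

theory Defs
  imports "HOL-Analysis.Analysis"
begin

text \<open>
  The size \<open>d\<close> is the cardinality of a finite (hence nonempty) index type \<open>'d\<close>.
  Rows and columns of \<open>2d \<times> 2d\<close> matrices are indexed by \<open>'d + 'd\<close>: \<open>Inl\<close> selects the
  first \<open>d\<close> coordinates, \<open>Inr\<close> the last \<open>d\<close>.
\<close>

definition block_matrix ::
  "real^'d^'d \<Rightarrow> real^'d^'d \<Rightarrow> real^'d^'d \<Rightarrow> real^'d^'d \<Rightarrow> real^('d::finite + 'd)^('d + 'd)"
  where
  "block_matrix A B C D =
     (\<chi> i j. case i of
        Inl r \<Rightarrow> (case j of Inl c \<Rightarrow> A $ r $ c | Inr c \<Rightarrow> B $ r $ c)
      | Inr r \<Rightarrow> (case j of Inl c \<Rightarrow> C $ r $ c | Inr c \<Rightarrow> D $ r $ c))"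

definition symplectic_form :: "real^('d::finite + 'd)^('d + 'd)" where
  "symplectic_form = block_matrix 0 (mat 1) (- mat 1) 0"

definition symplectic :: "real^('d::finite + 'd)^('d + 'd) \<Rightarrow> bool" where
  "symplectic H \<longleftrightarrow> transpose H ** symplectic_form ** H = symplectic_form"

definition symmetric :: "real^'n^'n \<Rightarrow> bool" where
  "symmetric A \<longleftrightarrow> transpose A = A"

definition positive_definite :: "real^'n^'n \<Rightarrow> bool" where
  "positive_definite A \<longleftrightarrow> (\<forall>x. x \<noteq> 0 \<longrightarrow> x \<bullet> (A *v x) > 0)"

definition SPP :: "(real^('d::finite + 'd)^('d + 'd)) set" where
  "SPP = {H. symmetric H \<and> positive_definite H \<and> symplectic H}"

definition upper :: "real^'d^'d \<Rightarrow> real^('d::finite + 'd)^('d + 'd)" where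
  "upper S = block_matrix (mat 1) S 0 (mat 1)"

definition lower :: "real^'d^'d \<Rightarrow> real^('d::finite + 'd)^('d + 'd)" where
  "lower S = block_matrix (mat 1) 0 S (mat 1)"

definition unit_triangular_symplectic :: "(real^('d::finite + 'd)^('d + 'd)) set" where
  "unit_triangular_symplectic = upper ` {S. symmetric S} \<union> lower ` {S. symmetric S}"

text \<open>\<open>descending_prod M n\<close> is \<open>M n ** \<dots> ** M 2 ** M 1\<close>; the indices start at 1.\<close>

primrec descending_prod :: "(nat \<Rightarrow> real^'n^'n) \<Rightarrow> nat \<Rightarrow> real^'n^'n" where
  "descending_prod M 0 = mat 1"
| "descending_prod M (Suc n) = M (Suc n) ** descending_prod M n"

definition alternating_products :: "nat \<Rightarrow> (real^('d::finite + 'd)^('d + 'd)) set"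
  where
  "alternating_products n =
     {descending_prod (\<lambda>i. if odd i then upper (S i) else lower (S i)) n
       | S. \<forall>i\<in>{1..n}. symmetric (S i)}"

end

theory Submission
  imports Defs
begin

text \<open>
  Let \<open>H\<close> be symmetric positive definite symplectic with blocks \<open>A, B, C, D\<close>. Then \<open>A\<close> is positive
  definite, hence invertible; put \<open>P = A\<inverse>\<close>. The symplectic relations make \<open>R = P B\<close> symmetric and give
  \<open>H = lower R \<cdot> diag(A, P) \<cdot> upper R\<close>. Moreover
  \<open>diag(A, P) = lower P \<cdot> upper (I - A) \<cdot> lower (- I) \<cdot> upper (I - P)\<close>, and the two lower factors
  on the left and the two upper factors on the right merge. The inclusion is proper because
  \<open>upper I\<close> is not symmetric.
\<close>

lemma sum_UNIV_Plus:
  "(\<Sum>k\<in>(UNIV :: ('a::finite + 'b::finite) set). f k) = (\<Sum>k\<in>UNIV. f (Inl k)) + (\<Sum>k\<in>UNIV. f (Inr k))"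
  by (simp add: UNIV_Plus_UNIV [symmetric] sum.Plus del: UNIV_Plus_UNIV)

lemma block_matrix_mult:
  "block_matrix A B C D ** block_matrix A' B' C' D' =
   block_matrix (A ** A' + B ** C') (A ** B' + B ** D') (C ** A' + D ** C') (C ** B' + D ** D')"
  by (simp add: vec_eq_iff matrix_matrix_mult_def block_matrix_def sum_UNIV_Plus split: sum.split)

lemma transpose_block_matrix:
  "transpose (block_matrix A B C D) =
   block_matrix (transpose A) (transpose C) (transpose B) (transpose D)"
  by (simp add: vec_eq_iff transpose_def block_matrix_def split: sum.split)

lemma block_matrix_eq_iff:
  "block_matrix A B C D = block_matrix A' B' C' D' \<longleftrightarrow> A = A' \<and> B = B' \<and> C = C' \<and> D = D'"
  by (auto simp: vec_eq_iff block_matrix_def split_sum_all)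

lemma block_matrix_cases:
  fixes H :: "real^('d::finite + 'd)^('d + 'd)"
  obtains A B C D where "H = block_matrix A B C D"
proof
  show "H = block_matrix (\<chi> r c. H $ Inl r $ Inl c) (\<chi> r c. H $ Inl r $ Inr c)
              (\<chi> r c. H $ Inr r $ Inl c) (\<chi> r c. H $ Inr r $ Inr c)"
    by (simp add: vec_eq_iff block_matrix_def split: sum.split)
qed

lemma mat_1_block_matrix: "mat 1 = block_matrix (mat 1) 0 0 (mat 1)"
  by (auto simp: vec_eq_iff block_matrix_def mat_def split: sum.split)

lemma transpose_add: "transpose (A + B) = transpose A + transpose (B :: 'a::plus^'n^'m)"
  by (simp add: vec_eq_iff transpose_def)

lemma transpose_diff: "transpose (A - B) = transpose A - transpose (B :: 'a::minus^'n^'m)"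
  by (simp add: vec_eq_iff transpose_def)

lemma transpose_uminus: "transpose (- A) = - transpose (A :: 'a::uminus^'n^'m)"
  by (simp add: vec_eq_iff transpose_def)

lemma matrix_mult_uminus_left: "(- A) ** B = - (A ** (B :: 'a::ring_1^'p^'n))"
  by (simp add: vec_eq_iff matrix_matrix_mult_def sum_negf)

lemma matrix_mult_uminus_right: "A ** (- B) = - (A ** (B :: 'a::ring_1^'p^'n))"
  by (simp add: vec_eq_iff matrix_matrix_mult_def sum_negf)

lemma matrix_mult_add_left: "(A + B) ** C = A ** C + B ** (C :: 'a::semiring_1^'p^'n)"
  by (simp add: vec_eq_iff matrix_matrix_mult_def distrib_right sum.distrib)

lemma matrix_mult_diff_left: "(A - B) ** C = A ** C - B ** (C :: 'a::ring_1^'p^'n)"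
  by (simp add: vec_eq_iff matrix_matrix_mult_def left_diff_distrib sum_subtractf)

lemma matrix_mult_diff_right: "A ** (B - C) = A ** B - A ** (C :: 'a::ring_1^'p^'n)"
  by (simp add: vec_eq_iff matrix_matrix_mult_def right_diff_distrib sum_subtractf)

text \<open>A nonzero kernel vector \<open>x\<close> would give
  \<open>x \<bullet> (A *v x) = 0\<close>, so the kernel is trivial, which for a square matrix
  yields an inverse.\<close>

lemma positive_definite_imp_invertible:
  fixes A :: "real^'n^'n"
  assumes "positive_definite A"
  shows "invertible A"
proof -
  have "x = 0" if "A *v x = 0" for x
    using assms that by (force simp: positive_definite_def)
  then show ?thesis
    using matrix_left_invertible_ker invertible_left_inverse by blast
qed

lemma positive_definite_block:
  assumes "positive_definite (block_matrix A B C D)"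
  shows "positive_definite A"
  unfolding positive_definite_def
proof (intro allI impI)
  fix x :: "real^'a"
  assume "x \<noteq> 0"
  \<comment> \<open>Padding \<open>x\<close> with zeros in the \<open>Inr\<close> half makes the
    quadratic form of the whole matrix see only the block \<open>A\<close>.\<close>
  define y :: "real^('a + 'a)" where "y = (\<chi> i. case i of Inl k \<Rightarrow> x $ k | Inr k \<Rightarrow> 0)"
  have "y \<noteq> 0"
    using \<open>x \<noteq> 0\<close> by (auto simp: y_def vec_eq_iff split_sum_ex)
  then have "y \<bullet> (block_matrix A B C D *v y) > 0"
    using assms by (simp add: positive_definite_def)
  also have "y \<bullet> (block_matrix A B C D *v y) = x \<bullet> (A *v x)"
    by (simp add: inner_vec_def matrix_vector_mult_def sum_UNIV_Plus y_def block_matrix_def)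
  finally show "x \<bullet> (A *v x) > 0" .
qed

lemma symmetric_block_matrix_iff:
  "symmetric (block_matrix A B C D) \<longleftrightarrow> symmetric A \<and> C = transpose B \<and> symmetric D"
  by (auto simp: symmetric_def transpose_block_matrix block_matrix_eq_iff)

text \<open>Symmetry turns the symplectic condition into
  \<open>H ** symplectic_form ** H = symplectic_form\<close>; the two upper blocks of this equation
  are the relations for \<open>A ** C\<close> and \<open>A ** D\<close>.\<close>

lemma SPP_block_matrixE:
  assumes "block_matrix A B C D \<in> SPP"
  obtains "symmetric A" "invertible A" "C = transpose B" "A ** C = B ** A"
    "A ** D = mat 1 + B ** B"
proof
  let ?H = "block_matrix A B C D"
  have H: "symmetric ?H" "positive_definite ?H" "symplectic ?H"
    using assms by (auto simp: SPP_def)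
  show "symmetric A" "C = transpose B"
    using H(1) by (auto simp: symmetric_block_matrix_iff)
  show "invertible A"
    using H(2) positive_definite_block positive_definite_imp_invertible by blast
  have "?H ** symplectic_form ** ?H = symplectic_form"
    using H(1,3) by (simp add: symmetric_def symplectic_def)
  then have "- (B ** A) + A ** C = 0" "- (B ** B) + A ** D = mat 1"
    by (simp_all add: symplectic_form_def block_matrix_mult block_matrix_eq_iff
        matrix_mult_uminus_left matrix_mult_uminus_right)
  then show "A ** C = B ** A" "A ** D = mat 1 + B ** B"
    by (simp_all add: algebra_simps)
qed

text \<open>Transposing \<open>A ** P = mat 1\<close> makes \<open>transpose P\<close> a left
  inverse of \<open>A\<close>, and a left inverse coincides with the right inverse
  \<open>P\<close>.\<close>

lemma symmetric_inverse:
  fixes A :: "real^'n^'n"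
  assumes "symmetric A" "A ** P = mat 1" "P ** A = mat 1"
  shows "symmetric P"
proof -
  have "transpose P ** A = mat 1"
    using assms(1,2) by (metis matrix_transpose_mul symmetric_def transpose_mat)
  then show ?thesis
    unfolding symmetric_def using assms(2) matrix_mul_assoc [of "transpose P" A P] by simp
qed

text \<open>The factorization after merging: the outer parameters are \<open>R + P\<close> and
  \<open>R + (mat 1 - P)\<close> with \<open>R = P ** B\<close>. Multiplying the relations for
  \<open>A ** C\<close> and \<open>A ** D\<close> by \<open>P\<close> on the left expresses
  \<open>C\<close> and \<open>D\<close> through \<open>A\<close>, \<open>B\<close> and
  \<open>P\<close>, and the blocks are then compared.\<close>

lemma lower_upper_lower_upper:
  fixes A B C D P :: "real^'d::finite^'d"
  assumes AP: "A ** P = mat 1" and PA: "P ** A = mat 1"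
    and AC: "A ** C = B ** A" and AD: "A ** D = mat 1 + B ** B"
  shows "lower (P ** B + P) ** (upper (mat 1 - A) ** (lower (- mat 1) ** upper (P ** B + mat 1 - P)))
         = block_matrix A B C D"
proof -
  have cancel: "A ** (P ** X) = X" "P ** (A ** X) = X" for X :: "real^'d^'d"
    by (simp_all add: matrix_mul_assoc AP PA)
  have PBA: "P ** B ** A = C"
    using cancel(2) [of C] by (simp add: AC matrix_mul_assoc)
  have D: "D = P + P ** B ** B"
    using cancel(2) [of D] by (simp add: AD matrix_add_ldistrib matrix_mul_assoc)
  show ?thesis
    by (simp add: lower_def upper_def block_matrix_mult block_matrix_eq_iff D PA AP PBA cancel
        matrix_add_ldistrib matrix_mult_add_left matrix_mult_diff_left matrix_mult_diff_right
        matrix_mult_uminus_left matrix_mult_uminus_right)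
qed

lemma alternating_products_4I:
  assumes "symmetric S1" "symmetric S2" "symmetric S3" "symmetric S4"
  shows "lower S4 ** (upper S3 ** (lower S2 ** upper S1)) \<in> alternating_products 4"
proof -
  \<comment> \<open>Only the indices 1 to 4 enter the product; the final branch serves index 4, and
    its value elsewhere is immaterial.\<close>
  define S where "S = (\<lambda>i::nat. if i = 1 then S1 else if i = 2 then S2 else if i = 3 then S3 else S4)"
  have "\<forall>i\<in>{1..4}. symmetric (S i)"
    using assms by (simp add: S_def)
  moreover have "descending_prod M 4 = M 4 ** (M 3 ** (M 2 ** M 1))" for M :: "nat \<Rightarrow> real^('a + 'a)^('a + 'a)"
    by (simp add: numeral_eq_Suc)
  then have "lower S4 ** (upper S3 ** (lower S2 ** upper S1)) =
      descending_prod (\<lambda>i. if odd i then upper (S i) else lower (S i)) 4"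
    by (simp add: S_def)
  ultimately show ?thesis
    unfolding alternating_products_def by blast
qed

lemma SPP_subset_alternating_products_4: "SPP \<subseteq> alternating_products 4"
proof
  fix H :: "real^('d::finite + 'd)^('d + 'd)"
  assume H: "H \<in> SPP"
  obtain A B C D where H_eq: "H = block_matrix A B C D"
    by (rule block_matrix_cases)
  from H have A: "symmetric A" "invertible A" and C: "C = transpose B"
    and AC: "A ** C = B ** A" and AD: "A ** D = mat 1 + B ** B"
    unfolding H_eq by (rule SPP_block_matrixE, simp)+
  obtain P where AP: "A ** P = mat 1" and PA: "P ** A = mat 1"
    using A(2) by (auto simp: invertible_def)
  have P: "symmetric P"
    using symmetric_inverse A(1) AP PA .
  \<comment> \<open>Multiplying \<open>A ** C = B ** A\<close> by \<open>P\<close> on both sides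
    leaves \<open>C ** P = P ** B\<close>. Since \<open>C = transpose B\<close> and \<open>P\<close>
    is symmetric, \<open>C ** P\<close> is the transpose of \<open>P ** B\<close>.\<close>
  have "P ** (A ** C) ** P = P ** B ** (A ** P)"
    by (simp add: AC matrix_mul_assoc)
  then have "P ** B = C ** P"
    by (simp add: AP PA matrix_mul_assoc)
  then have PB: "symmetric (P ** B)"
    using P by (simp add: symmetric_def matrix_transpose_mul C)
  show "H \<in> alternating_products 4"
    unfolding H_eq lower_upper_lower_upper [OF AP PA AC AD, symmetric]
    using A(1) P PB by (intro alternating_products_4I)
      (simp_all add: symmetric_def transpose_add transpose_diff transpose_uminus)
qed

text \<open>Symmetry would force the off-diagonal blocks \<open>mat 1\<close> and \<open>0\<close>
  to be transposes of each other, but \<open>mat 1\<close> is nonzero because index types are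
  nonempty.\<close>

lemma upper_mat_1_not_symmetric: "\<not> symmetric (upper (mat 1))"
proof -
  have "mat 1 \<noteq> (0 :: real^'n^'n)"
    by (auto simp: vec_eq_iff mat_def)
  then show ?thesis
    by (auto simp: upper_def symmetric_block_matrix_iff)
qed

lemma lower_0: "lower 0 = mat 1"
  by (simp add: lower_def mat_1_block_matrix)

lemma upper_0: "upper 0 = mat 1"
  by (simp add: upper_def mat_1_block_matrix)

text \<open>Zero parameters turn the three other factors into identities.\<close>

lemma upper_mat_1_in_alternating_products_4: "upper (mat 1) \<in> alternating_products 4"
proof -
  have "lower 0 ** (upper 0 ** (lower 0 ** upper (mat 1))) \<in> alternating_products 4"
    by (rule alternating_products_4I) (simp_all add: symmetric_def transpose_def vec_eq_iff mat_def)
  then show ?thesis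
    by (simp add: lower_0 upper_0)
qed

text \<open>Forgets the alternation of the factors and keeps only their type, as the second claim of
  the theorem requires.\<close>

lemma alternating_productsE:
  assumes "H \<in> alternating_products n"
  obtains M where "\<forall>i\<in>{1..n}. M i \<in> unit_triangular_symplectic" "H = descending_prod M n"
proof -
  obtain S where "\<forall>i\<in>{1..n}. symmetric (S i)"
    and "H = descending_prod (\<lambda>i. if odd i then upper (S i) else lower (S i)) n"
    using assms by (auto simp: alternating_products_def)
  then show ?thesis
    by (intro that [of "\<lambda>i. if odd i then upper (S i) else lower (S i)"])
      (auto simp: unit_triangular_symplectic_def)
qed

theorem theorem9:
  shows "(SPP :: (real^('d::finite + 'd)^('d + 'd)) set) \<subset> alternating_products 4 \<and>
    (\<forall>H \<in> (SPP :: (real^('d + 'd)^('d + 'd)) set).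
       \<exists>k M. 1 \<le> k \<and> k \<le> 4 \<and> (\<forall>i\<in>{1..k}. M i \<in> unit_triangular_symplectic)
         \<and> H = descending_prod M k)"
proof (intro conjI ballI)
  have "upper (mat 1) \<notin> (SPP :: (real^('d + 'd)^('d + 'd)) set)"
    using upper_mat_1_not_symmetric by (auto simp: SPP_def)
  then show "(SPP :: (real^('d + 'd)^('d + 'd)) set) \<subset> alternating_products 4"
    using SPP_subset_alternating_products_4 upper_mat_1_in_alternating_products_4 by blast
next
  fix H :: "real^('d + 'd)^('d + 'd)"
  assume "H \<in> SPP"
  then obtain M where "\<forall>i\<in>{1..4}. M i \<in> unit_triangular_symplectic" "H = descending_prod M 4"
    using SPP_subset_alternating_products_4 by (blast elim: alternating_productsE)
  then show "\<exists>k M. 1 \<le> k \<and> k \<le> 4 \<and> (\<forall>i\<in>{1..k}. M i \<in> unit_triangular_symplectic)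
      \<and> H = descending_prod M k"
    \<comment> \<open>The choice \<open>k = 4\<close> serves every \<open>H\<close>.\<close>
    by (intro exI [of _ 4] exI [of _ M]) simp
qed

end
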